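(* Let $\alpha\in(0,1)$. Then the function $$\sigma_\alpha(w)=w^{\alpha-1}E_{\alpha,1+\frac1\alpha,1}\left(-\frac{w^{1+\alpha}}{1+\alpha}\right)$$ is non-negative in $\mathbb{R}^+$, i.e. $\sigma_\alpha(w)\ge0$ for all $w>0$.
   Context: The three-parametric Mittag-Leffler function is, for $\alpha>0$, $m>0$ and $l$ with $\alpha(jm+l)\neq-1,-2,-3,\dots$ for $j=0,1,2,\dots$, $$E_{\alpha,m,l}(z)=\sum_{n=0}^\infty c_nz^n,\qquad c_0=1,\quad c_n=\prod_{j=0}^{n-1}\frac{\Gamma(\alpha(jm+l)+1)}{\Gamma(\alpha(jm+l+1)+1)}\ (n\ge1).$$ *)

theory Defs
  imports "HOL-Analysis.Analysis"
begin

text \<open>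
  The three-parametric Mittag-Leffler (Kilbas--Saigo) function \<open>E\<^bsub>\<alpha>,m,l\<^esub>\<close>. The coefficients are
  meaningful if \<open>\<alpha> > 0\<close>, \<open>m > 0\<close> and \<open>\<alpha> (j m + l)\<close> is not a negative integer for any natural
  number \<open>j\<close>; the power series then converges everywhere.
\<close>

definition mittag_leffler3_coeff :: "real \<Rightarrow> real \<Rightarrow> real \<Rightarrow> nat \<Rightarrow> real" where
  "mittag_leffler3_coeff \<alpha> m l n =
     (\<Prod>j<n. Gamma (\<alpha> * (real j * m + l) + 1) / Gamma (\<alpha> * (real j * m + l + 1) + 1))"

definition mittag_leffler3 ::
    "real \<Rightarrow> real \<Rightarrow> real \<Rightarrow> 'a::{real_normed_field, banach} \<Rightarrow> 'a" where
  "mittag_leffler3 \<alpha> m l z = (\<Sum>n. of_real (mittag_leffler3_coeff \<alpha> m l n) * z ^ n)"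

definition sigma_alpha :: "real \<Rightarrow> real \<Rightarrow> real" where
  "sigma_alpha \<alpha> w =
     w powr (\<alpha> - 1) * mittag_leffler3 \<alpha> (1 + 1 / \<alpha>) 1 (- (w powr (1 + \<alpha>) / (1 + \<alpha>)))"

end

theory Submission
  imports Defs "HOL-Real_Asymp.Real_Asymp"
begin

text \<open>
  The function \<open>\<sigma>\<close> solves \<open>D\<^sup>\<alpha> \<sigma> = - w \<sigma> / (1 + \<alpha>)\<close> for the Riemann--Liouville derivative. At a first
  zero the right-hand side vanishes, but the Marchaud form of the left-hand side is a negative
  multiple of \<open>\<integral> \<sigma>(s) (t - s)\<^bsup>- \<alpha> - 1\<^esup> ds > 0\<close>, a contradiction. After rescaling the first zero to \<open>1\<close> and
  writing \<open>\<sigma>(u) = u\<^bsup>\<alpha> - 1\<^esup> h(u)\<close>, the vanishing right-hand side becomes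
  \<open>\<integral> h'(u) (u / (1 - u))\<^sup>\<alpha> du = 0\<close> over \<open>[0, 1]\<close>, which is checked termwise with Beta integrals: they turn
  the coefficient recursion into a shift of the power series.
\<close>

section \<open>Coefficient ratios and convergence of the series\<close>

text \<open>Log-convexity of Gamma at \<open>q + 1\<close>, the convex combination of
  \<open>q + \<alpha>\<close> and \<open>q + \<alpha> + 1\<close> with weights
  \<open>\<alpha>\<close> and \<open>1 - \<alpha>\<close>. The bound decays like
  \<open>q powr (-\<alpha>)\<close>, which is what the ratio test needs.\<close>

lemma Gamma_quotient_le_powr:
  fixes q \<alpha> :: real
  assumes "0 < \<alpha>" "\<alpha> < 1" "0 < q"
  shows "Gamma q / Gamma (q + \<alpha>) \<le> (q + \<alpha>) powr (1 - \<alpha>) / q"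
proof -
  have pos: "Gamma (q + \<alpha>) > 0" "Gamma (q + \<alpha> + 1) > 0" "Gamma (q + 1) > 0"
    using assms by (auto intro!: Gamma_real_pos)
  have "(ln \<circ> Gamma) ((1 - (1 - \<alpha>)) *\<^sub>R (q + \<alpha>) + (1 - \<alpha>) *\<^sub>R (q + \<alpha> + 1))
      \<le> (1 - (1 - \<alpha>)) * (ln \<circ> Gamma) (q + \<alpha>) + (1 - \<alpha>) * (ln \<circ> Gamma) (q + \<alpha> + 1)"
    using assms by (intro convex_onD[OF log_convex_Gamma_real]) auto
  also have "(1 - (1 - \<alpha>)) *\<^sub>R (q + \<alpha>) + (1 - \<alpha>) *\<^sub>R (q + \<alpha> + 1) = q + 1"
    by (simp add: algebra_simps)
  finally have "ln (Gamma (q + 1)) \<le> \<alpha> * ln (Gamma (q + \<alpha>)) + (1 - \<alpha>) * ln (Gamma (q + \<alpha> + 1))"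
    by simp
  also have "Gamma (q + \<alpha> + 1) = (q + \<alpha>) * Gamma (q + \<alpha>)"
    using assms by (intro Gamma_plus1) (auto elim!: nonpos_Ints_cases)
  also have "ln \<dots> = ln (q + \<alpha>) + ln (Gamma (q + \<alpha>))"
    using assms pos by (intro ln_mult_pos) auto
  finally have "ln (Gamma (q + 1)) \<le> ln ((q + \<alpha>) powr (1 - \<alpha>) * Gamma (q + \<alpha>))"
    using assms pos by (simp add: ln_mult_pos ln_powr algebra_simps)
  then have "Gamma (q + 1) \<le> (q + \<alpha>) powr (1 - \<alpha>) * Gamma (q + \<alpha>)"
    using assms pos by (subst (asm) ln_le_cancel_iff) auto
  moreover have "Gamma (q + 1) = q * Gamma q"
    using assms by (intro Gamma_plus1) (auto elim!: nonpos_Ints_cases)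
  ultimately show ?thesis
    using assms pos by (simp add: field_simps)
qed

text \<open>Since \<open>\<alpha> * (1 + 1 / \<alpha>) = 1 + \<alpha>\<close>, the Gamma arguments
  become \<open>q\<close> and \<open>q + \<alpha>\<close> with \<open>q\<close> a multiple of
  \<open>1 + \<alpha>\<close>. This ratio is inverse to the one produced by the Beta integral in
  \<open>has_integral_powr_Beta\<close>.\<close>

lemma mittag_leffler3_coeff_Suc:
  fixes \<alpha> :: real
  assumes "\<alpha> \<noteq> 0"
  shows "mittag_leffler3_coeff \<alpha> (1 + 1 / \<alpha>) 1 (Suc n) = mittag_leffler3_coeff \<alpha> (1 + 1 / \<alpha>) 1 n *
    (Gamma ((1 + \<alpha>) * real (Suc n)) / Gamma ((1 + \<alpha>) * real (Suc n) + \<alpha>))"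
proof -
  have "\<alpha> * (real n * (1 + 1 / \<alpha>) + 1) + 1 = (1 + \<alpha>) * real (Suc n)"
    "\<alpha> * (real n * (1 + 1 / \<alpha>) + 1 + 1) + 1 = (1 + \<alpha>) * real (Suc n) + \<alpha>"
    using assms by (auto simp: field_simps)
  then show ?thesis
    by (simp add: mittag_leffler3_coeff_def)
qed

lemma mittag_leffler3_coeff_0 [simp]: "mittag_leffler3_coeff \<alpha> m l 0 = 1"
  by (simp add: mittag_leffler3_coeff_def)

lemma summable_mittag_leffler3:
  fixes \<alpha> x :: real
  assumes \<alpha>: "0 < \<alpha>" "\<alpha> < 1"
  shows "summable (\<lambda>n. mittag_leffler3_coeff \<alpha> (1 + 1 / \<alpha>) 1 n * x ^ n)"
proof -
  define c where "c = mittag_leffler3_coeff \<alpha> (1 + 1 / \<alpha>) 1"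
  define r where "r n = Gamma ((1 + \<alpha>) * real (Suc n)) / Gamma ((1 + \<alpha>) * real (Suc n) + \<alpha>)" for n
  have r0: "r n \<ge> 0" for n
    using \<alpha> unfolding r_def
    by (intro divide_nonneg_nonneg Gamma_real_nonneg add_pos_pos mult_pos_pos) auto
  have c_Suc: "c (Suc n) = c n * r n" for n
    using \<alpha> unfolding c_def r_def by (intro mittag_leffler3_coeff_Suc) auto
  \<comment> \<open>The ratio bound is of order \<open>n powr (-\<alpha>)\<close>, so it eventually
    beats any fixed factor \<open>\<bar>x\<bar>\<close>.\<close>
  have "(\<lambda>n. ((1 + \<alpha>) * real (Suc n) + \<alpha>) powr (1 - \<alpha>) / ((1 + \<alpha>) * real (Suc n)) * \<bar>x\<bar>) \<longlonglongrightarrow> 0"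
    using \<alpha> by real_asymp
  then have "eventually (\<lambda>n. ((1 + \<alpha>) * real (Suc n) + \<alpha>) powr (1 - \<alpha>) / ((1 + \<alpha>) * real (Suc n)) * \<bar>x\<bar> < 1/2) sequentially"
    by (rule order_tendstoD) simp
  then obtain N where N: "\<And>n. n \<ge> N \<Longrightarrow>
      ((1 + \<alpha>) * real (Suc n) + \<alpha>) powr (1 - \<alpha>) / ((1 + \<alpha>) * real (Suc n)) * \<bar>x\<bar> < 1/2"
    by (auto simp: eventually_sequentially)
  have "summable (\<lambda>n. c n * x ^ n)"
  proof (rule summable_ratio_test[of "1/2" N])
    fix n assume n: "n \<ge> N"
    have "r n * \<bar>x\<bar> \<le> ((1 + \<alpha>) * real (Suc n) + \<alpha>) powr (1 - \<alpha>) / ((1 + \<alpha>) * real (Suc n)) * \<bar>x\<bar>"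
      unfolding r_def using \<alpha> by (intro mult_right_mono Gamma_quotient_le_powr) auto
    then have le: "r n * \<bar>x\<bar> \<le> 1/2"
      using N[OF n] by linarith
    have "norm (c (Suc n) * x ^ Suc n) = (r n * \<bar>x\<bar>) * norm (c n * x ^ n)"
      using r0[of n] c_Suc[of n] by (simp add: abs_mult power_abs)
    also have "\<dots> \<le> 1/2 * norm (c n * x ^ n)"
      using le by (intro mult_right_mono) auto
    finally show "norm (c (Suc n) * x ^ Suc n) \<le> 1/2 * norm (c n * x ^ n)" .
  qed simp
  then show ?thesis
    by (simp add: c_def)
qed

section \<open>The singular integral at a first zero\<close>

text \<open>Only \<open>u = 1\<close> is delicate: differentiability with \<open>h 1 = 0\<close>
  gives \<open>h u = O(1 - u)\<close>, so the product is \<open>O((1 - u) powr (1 - a))\<close> and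
  tends to 0. This controls the boundary term of the integration by parts.\<close>

lemma continuous_on_mult_powr_at_1:
  fixes h :: "real \<Rightarrow> real" and a :: real
  assumes a: "0 < a" "a < 1" and cont: "continuous_on {0..1} h"
    and D: "(h has_real_derivative D) (at 1)" and h1: "h 1 = 0"
  shows "continuous_on {0..1} (\<lambda>u. h u * (u powr a * (1 - u) powr (-a)))"
  unfolding continuous_on_eq_continuous_within
proof
  fix x :: real assume x: "x \<in> {0..1}"
  show "continuous (at x within {0..1}) (\<lambda>u. h u * (u powr a * (1 - u) powr (-a)))"
  proof (cases "x = 1")
    case False
    have "continuous (at x within {0..1}) h"
      using cont x by (simp add: continuous_on_eq_continuous_within)
    moreover have "continuous (at x within {0..1}) (\<lambda>u. u powr a * (1 - u) powr (-a))"
      unfolding continuous_within using False x a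
      by (intro tendsto_intros) (auto simp: eventually_at_filter)
    ultimately show ?thesis
      by (rule continuous_mult)
  next
    case True
    have "((\<lambda>u. (h u - h 1) / (u - 1)) \<longlongrightarrow> D) (at 1 within {0..1})"
      using D has_field_derivative_at_within[of h D 1 "{0..1}"] by (simp add: has_field_derivative_iff)
    moreover have "((\<lambda>u. u powr a * (1 - u) powr (1 - a)) \<longlongrightarrow> 1 powr a * (1 - 1) powr (1 - a)) (at 1 within {0..1::real})"
      using a by (intro tendsto_intros) (auto simp: eventually_at_filter)
    ultimately have "((\<lambda>u. - ((h u - h 1) / (u - 1) * (u powr a * (1 - u) powr (1 - a)))) \<longlongrightarrow>
        - (D * (1 powr a * (1 - 1) powr (1 - a)))) (at 1 within {0..1})"
      by (rule tendsto_minus[OF tendsto_mult])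
    then have "((\<lambda>u. - ((h u - h 1) / (u - 1) * (u powr a * (1 - u) powr (1 - a)))) \<longlongrightarrow> 0) (at 1 within {0..1})"
      using a by simp
    also have "?this \<longleftrightarrow> ((\<lambda>u. h u * (u powr a * (1 - u) powr (-a))) \<longlongrightarrow> 0) (at 1 within {0..1})"
    proof (rule filterlim_cong[OF refl refl])
      show "\<forall>\<^sub>F u in at 1 within {0..1}. - ((h u - h 1) / (u - 1) * (u powr a * (1 - u) powr (1 - a)))
          = h u * (u powr a * (1 - u) powr (-a))"
        unfolding eventually_at_filter
      proof (intro always_eventually allI impI)
        fix u :: real assume u: "u \<noteq> 1" "u \<in> {0..1}"
        then have "(1 - u) powr (1 - a) = (1 - u) * (1 - u) powr (-a)"
          by (simp add: powr_diff powr_minus_divide)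
        then show "- ((h u - h 1) / (u - 1) * (u powr a * (1 - u) powr (1 - a)))
            = h u * (u powr a * (1 - u) powr (-a))"
          using u h1 by (simp add: divide_simps) (simp add: algebra_simps)
      qed
    qed
    finally show ?thesis
      using True a by (simp add: continuous_within)
  qed
qed

text \<open>Integrating by parts, \<open>- \<integral> h'(u) (u / (1 - u))\<^sup>a du\<close> equals
  \<open>a \<integral> h(u) u\<^bsup>a - 1\<^esup> (1 - u)\<^bsup>- a - 1\<^esup> du > 0\<close>; comparing derivatives avoids the second improper integral.\<close>
lemma integral_deriv_mult_powr_nonzero:
  fixes h h' :: "real \<Rightarrow> real" and a :: real
  assumes a: "0 < a" "a < 1" and cont: "continuous_on {0..1} h" and cont': "continuous_on {0<..<1} h'"
    and D: "\<And>u. 0 < u \<Longrightarrow> (h has_real_derivative h' u) (at u)"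
    and h1: "h 1 = 0" and hpos: "\<And>u. 0 < u \<Longrightarrow> u < 1 \<Longrightarrow> h u > 0"
  shows "\<not> ((\<lambda>u. h' u * (u powr a * (1 - u) powr (-a))) has_integral 0) {0..1}"
proof
  let ?k = "\<lambda>u. h' u * (u powr a * (1 - u) powr (-a))"
  let ?H = "\<lambda>u. h u * (u powr a * (1 - u) powr (-a))"
  let ?G = "\<lambda>u. integral {0..u} ?k"
  assume int: "(?k has_integral 0) {0..1}"
  \<comment> \<open>All four values are 0, so strict decrease is absurd. The decrease holds because
    \<open>?k\<close> cancels in the derivative of \<open>?G - ?H\<close>, leaving minus
    \<open>h\<close> times the derivative of the increasing weight
    \<open>(u / (1 - u)) powr a\<close>.\<close>
  have "?G 1 - ?H 1 < ?G 0 - ?H 0"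
  proof (rule DERIV_neg_imp_decreasing_open[of 0 1 "\<lambda>u. ?G u - ?H u"])
    show "continuous_on {0..1} (\<lambda>u. ?G u - ?H u)"
      using int D[of 1] h1
      by (intro continuous_on_diff indefinite_integral_continuous_1
          continuous_on_mult_powr_at_1 a cont) (auto simp: has_integral_integrable)
  next
    fix x :: real assume x: "0 < x" "x < 1"
    have "continuous_on {0<..<1} ?k"
      using a by (intro continuous_intros cont') auto
    then have "continuous (at x within {0..1}) ?k"
      using x by (simp add: continuous_on_eq_continuous_at continuous_at_imp_continuous_at_within)
    then have "(?G has_vector_derivative ?k x) (at x within {0..1})"
      using x has_integral_integrable[OF int]
        integral_has_vector_derivative_continuous_at[of ?k 0 1 x "{}"] by simp
    then have G: "(?G has_real_derivative ?k x) (at x)"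
      using x unfolding has_real_derivative_iff_has_vector_derivative by (simp only: at_within_Icc_at)
    have "((\<lambda>u. u powr a * (1 - u) powr (-a)) has_real_derivative
        a * x powr (a - 1) * (1 - x) powr (-a) + x powr a * (a * (1 - x) powr (-a - 1))) (at x)"
      using x by (auto intro!: derivative_eq_intros simp: powr_diff divide_simps)
    then have H: "(?H has_real_derivative ?k x + h x *
        (a * x powr (a - 1) * (1 - x) powr (-a) + x powr a * (a * (1 - x) powr (-a - 1)))) (at x)"
      using DERIV_mult[OF D[OF x(1)]] by (simp only: mult.commute[of "h x"])
    have "h x * (a * x powr (a - 1) * (1 - x) powr (-a) + x powr a * (a * (1 - x) powr (-a - 1))) > 0"
      using x a hpos[of x] by (intro mult_pos_pos add_pos_pos) auto
    with DERIV_diff[OF G H]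
    show "\<exists>y. ((\<lambda>u. ?G u - ?H u) has_real_derivative y) (at x) \<and> y < 0"
      by (intro exI[of _ "?k x - (?k x + h x *
        (a * x powr (a - 1) * (1 - x) powr (-a) + x powr a * (a * (1 - x) powr (-a - 1))))"]) auto
  qed simp
  then show False
    using int h1 a by (simp add: integral_unique)
qed

section \<open>Termwise integration and the shift of the series\<close>

text \<open>The factor \<open>q\<close>, which comes from differentiating \<open>u powr q\<close>,
  cancels against \<open>Gamma (q + 1) = q * Gamma q\<close> in the denominator of the Beta
  function.\<close>

lemma has_integral_powr_Beta:
  fixes \<alpha> q :: real
  assumes \<alpha>: "0 < \<alpha>" "\<alpha> < 1" and q: "q > 0"
  shows "((\<lambda>u. q * (u powr (q - 1 + \<alpha>) * (1 - u) powr (-\<alpha>))) has_integral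
    Gamma (1 - \<alpha>) * (Gamma (q + \<alpha>) / Gamma q)) {0..1}"
proof -
  have "((\<lambda>u. q * (u powr ((q + \<alpha>) - 1) * (1 - u) powr ((1 - \<alpha>) - 1))) has_integral
     q * Beta (q + \<alpha>) (1 - \<alpha>)) {0..1}"
    using assms by (intro has_integral_mult_right has_integral_Beta_real) auto
  moreover have "Gamma (q + 1) = q * Gamma q"
    using q by (intro Gamma_plus1) (auto elim!: nonpos_Ints_cases)
  then have "q * Beta (q + \<alpha>) (1 - \<alpha>) = Gamma (1 - \<alpha>) * (Gamma (q + \<alpha>) / Gamma q)"
    using q by (simp add: Beta_def)
  ultimately show ?thesis
    by (simp add: algebra_simps)
qed

text \<open>If \<open>F\<close> were positive on the open segment from 0 to \<open>y\<close>, then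
  \<open>h u = F (y * u powr (1 + \<alpha>))\<close> would satisfy the hypotheses of
  \<open>integral_deriv_mult_powr_nonzero\<close>. But termwise integration gives that integral the
  value \<open>Gamma (1 - \<alpha>) * y * F y = 0\<close>.\<close>

lemma mittag_leffler3_no_first_zero:
  fixes \<alpha> y :: real
  defines "F \<equiv> mittag_leffler3 \<alpha> (1 + 1 / \<alpha>) 1 :: real \<Rightarrow> real"
  assumes \<alpha>: "0 < \<alpha>" "\<alpha> < 1" and zero: "F y = 0"
  shows "\<exists>v. 0 < v \<and> v < 1 \<and> F (y * v) \<le> 0"
proof (rule ccontr)
  assume "\<not> ?thesis"
  then have pos: "\<And>v. 0 < v \<Longrightarrow> v < 1 \<Longrightarrow> F (y * v) > 0"
    by force
  define c where "c = mittag_leffler3_coeff \<alpha> (1 + 1 / \<alpha>) 1"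
  define F' where "F' x = (\<Sum>n. diffs c n * x ^ n)" for x
  define q where "q n = (1 + \<alpha>) * real n" for n
  define h' where "h' u = F' (y * u powr (1 + \<alpha>)) * (y * ((1 + \<alpha>) * u powr \<alpha>))" for u
  \<comment> \<open>The derivative of the term \<open>c n * y ^ n * u powr (q n)\<close> of
    \<open>h\<close>, times the weight \<open>(u / (1 - u)) powr \<alpha>\<close>.\<close>
  define t where "t n u = c n * y ^ n * (q n * (u powr (q n - 1 + \<alpha>) * (1 - u) powr (-\<alpha>)))" for n u
  have F: "F x = (\<Sum>n. c n * x ^ n)" for x
    by (simp add: F_def mittag_leffler3_def c_def)
  have summ: "summable (\<lambda>n. c n * x ^ n)" for x
    using summable_mittag_leffler3[OF \<alpha>] by (simp add: c_def)
  have DF: "(F has_real_derivative F' x) (at x)" for x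
    unfolding F'_def F[abs_def] by (intro termdiffs_strong_converges_everywhere summ)
  have summ': "summable (\<lambda>n. diffs c n * x ^ n)" for x
    by (intro termdiff_converges_all summ)
  have contF': "isCont F' x" for x
    unfolding F'_def by (rule isCont_powser_converges_everywhere[OF summ'])

  have tsums: "(\<lambda>n. t n u) sums (h' u * (u powr \<alpha> * (1 - u) powr (-\<alpha>)))"
    if u: "0 \<le> u" "u \<le> 1" for u
  proof (cases "u = 0")
    case True
    have "t n u = 0" for n
      using True by (simp add: t_def)
    then show ?thesis using True \<alpha> by (simp add: h'_def)
  next
    case False
    define X where "X = y * u powr (1 + \<alpha>)"
    define C where "C = y * ((1 + \<alpha>) * u powr \<alpha>) * (u powr \<alpha> * (1 - u) powr (-\<alpha>))"
    have "(\<lambda>n. diffs c n * X ^ n * C) sums (F' X * C)"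
      unfolding F'_def by (intro sums_mult2 summable_sums summ')
    moreover have "diffs c n * X ^ n * C = t (Suc n) u" for n
    proof -
      have "X ^ n = y ^ n * u powr (q n)"
        using False u by (simp add: X_def q_def power_mult_distrib powr_powr flip: powr_realpow)
      moreover have "u powr (q (Suc n) - 1 + \<alpha>) = u powr q n * u powr \<alpha> * u powr \<alpha>"
        by (simp add: q_def algebra_simps flip: powr_add)
      ultimately show ?thesis
        by (simp add: diffs_def C_def t_def q_def algebra_simps)
    qed
    ultimately have "(\<lambda>n. t (Suc n) u) sums (F' X * C)"
      by simp
    then have "(\<lambda>n. t n u) sums (F' X * C + t 0 u)"
      by (subst (asm) sums_Suc_iff) simp
    then show ?thesis
      by (simp add: t_def q_def h'_def X_def C_def algebra_simps)
  qed

  \<comment> \<open>The Beta integral cancels the last factor of \<open>c n\<close>, so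
    \<open>t n\<close> integrates to a multiple of the preceding term of the series for
    \<open>F y\<close>; \<open>t 0\<close> vanishes because \<open>q 0 = 0\<close>.\<close>
  have tint: "(t n has_integral (if n = 0 then 0 else Gamma (1 - \<alpha>) * y * (c (n - 1) * y ^ (n - 1)))) {0..1}" for n
  proof (cases n)
    case 0
    then show ?thesis by (simp add: t_def[abs_def] q_def)
  next
    case (Suc m)
    have qpos: "q n > 0" using \<alpha> Suc by (simp add: q_def)
    have "Gamma (q n) > 0" "Gamma (q n + \<alpha>) > 0"
      using qpos \<alpha> by (auto intro!: Gamma_real_pos)
    moreover have "c n = c m * (Gamma (q n) / Gamma (q n + \<alpha>))"
      using mittag_leffler3_coeff_Suc[of \<alpha> m] \<alpha> by (simp add: Suc c_def q_def)
    ultimately have "c n * y ^ n * (Gamma (1 - \<alpha>) * (Gamma (q n + \<alpha>) / Gamma (q n)))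
        = Gamma (1 - \<alpha>) * y * (c m * y ^ m)"
      by (simp add: Suc)
    with has_integral_mult_right[OF has_integral_powr_Beta[OF \<alpha> qpos], of "c n * y ^ n"]
    show ?thesis
      by (simp add: t_def[abs_def] Suc)
  qed

  \<comment> \<open>For \<open>n \<ge> 1\<close> the exponent \<open>q n - 1 + \<alpha>\<close> is
    nonnegative, so the power of \<open>u\<close> in \<open>t n u\<close> is at most 1 and
    \<open>M * (1 - u) powr (-\<alpha>)\<close> dominates all partial sums.\<close>
  define M where "M = (\<Sum>n. \<bar>c n * y ^ n\<bar> * q n)"
  have Msum: "summable (\<lambda>n. \<bar>c n * y ^ n\<bar> * q n)"
  proof -
    have "summable (\<lambda>n. \<bar>diffs c n * y ^ n\<bar>)"
      using powser_insidea[OF summ'[of "\<bar>y\<bar> + 1"], of y] by simp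
    then have "summable (\<lambda>n. \<bar>diffs c n * y ^ n\<bar> * (\<bar>y\<bar> * (1 + \<alpha>)))"
      by (rule summable_mult2)
    moreover have "\<bar>diffs c n * y ^ n\<bar> * (\<bar>y\<bar> * (1 + \<alpha>)) = \<bar>c (Suc n) * y ^ Suc n\<bar> * q (Suc n)" for n
      using \<alpha> by (simp add: diffs_def q_def abs_mult)
    ultimately show ?thesis
      by (subst summable_Suc_iff[symmetric]) simp
  qed
  have tbound: "\<bar>\<Sum>n<k. t n u\<bar> \<le> M * (1 - u) powr (-\<alpha>)" if u: "0 \<le> u" "u \<le> 1" for k u
  proof -
    have "\<bar>t n u\<bar> \<le> \<bar>c n * y ^ n\<bar> * q n * (1 - u) powr (-\<alpha>)" for n
    proof (cases "n = 0")
      case False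
      then have "1 * 1 \<le> (1 + \<alpha>) * real n"
        using \<alpha> by (intro mult_mono) auto
      then have "q n - 1 + \<alpha> \<ge> 0" using \<alpha> by (simp add: q_def)
      then have "u powr (q n - 1 + \<alpha>) \<le> 1"
        using u by (intro powr_le1) auto
      then have "\<bar>c n * y ^ n\<bar> * (q n * (u powr (q n - 1 + \<alpha>) * (1 - u) powr (-\<alpha>))) \<le>
          \<bar>c n * y ^ n\<bar> * (q n * (1 * (1 - u) powr (-\<alpha>)))"
        using \<alpha> by (intro mult_left_mono mult_right_mono) (auto simp: q_def)
      then show ?thesis
        using \<alpha> by (simp add: t_def abs_mult q_def mult_ac)
    qed (simp add: t_def q_def)
    then have "\<bar>\<Sum>n<k. t n u\<bar> \<le> (\<Sum>n<k. \<bar>c n * y ^ n\<bar> * q n * (1 - u) powr (-\<alpha>))"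
      by (intro order_trans[OF sum_abs] sum_mono)
    also have "\<dots> = (\<Sum>n<k. \<bar>c n * y ^ n\<bar> * q n) * (1 - u) powr (-\<alpha>)"
      by (simp add: sum_distrib_right)
    also have "\<dots> \<le> M * (1 - u) powr (-\<alpha>)"
      unfolding M_def using \<alpha>
      by (intro mult_right_mono sum_le_suminf Msum) (auto simp: q_def)
    finally show ?thesis .
  qed

  let ?k = "\<lambda>u. h' u * (u powr \<alpha> * (1 - u) powr (-\<alpha>))"
  have ints: "((\<lambda>u. \<Sum>n<k. t n u) has_integral
      (\<Sum>n<k. if n = 0 then 0 else Gamma (1 - \<alpha>) * y * (c (n - 1) * y ^ (n - 1)))) {0..1}" for k
    by (intro has_integral_sum tint) auto
  have dom: "(\<lambda>u. M * (1 - u) powr (-\<alpha>)) integrable_on {0..1::real}"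
  proof -
    have "((\<lambda>u. u powr (1 - 1) * (1 - u) powr ((1 - \<alpha>) - 1)) has_integral Beta 1 (1 - \<alpha>)) {0..1::real}"
      using \<alpha> by (intro has_integral_Beta_real) auto
    \<comment> \<open>The factor \<open>u powr (1 - 1)\<close> is 1 except at \<open>u = 0\<close>,
      where \<open>0 powr 0 = 0\<close>; hence the exceptional point.\<close>
    then have "((\<lambda>u. (1 - u) powr (-\<alpha>)) has_integral Beta 1 (1 - \<alpha>)) {0..1::real}"
      by (rule has_integral_spike[OF negligible_sing[of 0], rotated]) auto
    then show ?thesis
      by (intro integrable_on_mult_right) (auto simp: has_integral_integrable)
  qed
  have lim: "(\<lambda>k. \<Sum>n<k. t n u) \<longlonglongrightarrow> ?k u" if "u \<in> {0..1}" for u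
    using tsums[of u] that by (simp add: sums_def)
  have bound: "norm (\<Sum>n<k. t n u) \<le> M * (1 - u) powr (-\<alpha>)" if "u \<in> {0..1}" for k u
    using tbound[of u k] that by simp
  note conv = dominated_convergence[OF has_integral_integrable[OF ints] dom bound lim]
  have "(\<lambda>n. Gamma (1 - \<alpha>) * y * (c n * y ^ n)) sums (Gamma (1 - \<alpha>) * y * F y)"
    unfolding F by (intro sums_mult summable_sums summ)
  \<comment> \<open>The series is shifted by one index with 0 in front, so its sum is still the
    multiple of \<open>F y\<close>, which is 0.\<close>
  then have "(\<lambda>n. if n = 0 then 0 else Gamma (1 - \<alpha>) * y * (c (n - 1) * y ^ (n - 1))) sums 0"
    using sums_Suc[of "\<lambda>n. if n = 0 then 0 else Gamma (1 - \<alpha>) * y * (c (n - 1) * y ^ (n - 1))"] zero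
    by simp
  then have "(\<lambda>k. integral {0..1} (\<lambda>u. \<Sum>n<k. t n u)) \<longlonglongrightarrow> 0"
    using integral_unique[OF ints] by (simp add: sums_def)
  with conv(2) have "integral {0..1} ?k = 0"
    by (rule LIMSEQ_unique)
  with conv(1) have int0: "(?k has_integral 0) {0..1}"
    by (metis integrable_integral)

  have "\<not> (?k has_integral 0) {0..1}"
  proof (rule integral_deriv_mult_powr_nonzero[OF \<alpha>, where h = "\<lambda>u. F (y * u powr (1 + \<alpha>))"])
    show "F (y * 1 powr (1 + \<alpha>)) = 0"
      using zero by simp
    show "F (y * u powr (1 + \<alpha>)) > 0" if "0 < u" "u < 1" for u
      using that \<alpha> powr_less_mono2[of "1 + \<alpha>" u 1] by (intro pos) auto
    have contF: "continuous_on UNIV F" "continuous_on UNIV F'"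
      using DF contF' by (blast intro: continuous_at_imp_continuous_on DERIV_isCont)+
    show "continuous_on {0..1} (\<lambda>u. F (y * u powr (1 + \<alpha>)))"
      using \<alpha> by (intro continuous_on_compose2[OF contF(1)] continuous_on_mult continuous_on_powr'
          continuous_on_const continuous_on_id) auto
    show "continuous_on {0<..<1} h'"
      unfolding h'_def using \<alpha>
      by (intro continuous_intros continuous_on_compose2[OF contF(2)]) auto
    show "((\<lambda>u. F (y * u powr (1 + \<alpha>))) has_real_derivative h' u) (at u)" if "0 < u" for u
    proof -
      have "((\<lambda>u. y * u powr (1 + \<alpha>)) has_real_derivative y * ((1 + \<alpha>) * u powr \<alpha>)) (at u)"
        using that by (auto intro!: derivative_eq_intros)
      then show ?thesis
        unfolding h'_def by (rule DERIV_chain2[OF DF])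
    qed
  qed
  with int0 show False by blast
qed

section \<open>From the absence of a first zero to nonnegativity\<close>

text \<open>A negative value and \<open>f 0 = 1\<close> force a zero, and compactness of the zero
  set in \<open>{0..x}\<close> yields a smallest one, \<open>z\<close>. The previous lemma at
  \<open>y = - z\<close> then leads to a smaller zero.\<close>

lemma mittag_leffler3_nonneg:
  fixes \<alpha> x :: real
  assumes \<alpha>: "0 < \<alpha>" "\<alpha> < 1" and x: "x \<ge> 0"
  shows "mittag_leffler3 \<alpha> (1 + 1 / \<alpha>) 1 (- x) \<ge> 0"
proof (rule ccontr)
  define f where "f x = mittag_leffler3 \<alpha> (1 + 1 / \<alpha>) 1 (- x)" for x :: real
  assume "\<not> ?thesis"
  then have neg: "f x < 0" by (simp add: f_def)
  have f0: "f 0 = 1"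
    by (simp add: f_def mittag_leffler3_def)
  have "isCont (mittag_leffler3 \<alpha> (1 + 1 / \<alpha>) 1) x" for x :: real
    using isCont_powser_converges_everywhere[OF summable_mittag_leffler3[OF \<alpha>]]
    by (simp add: mittag_leffler3_def[abs_def])
  then have contf: "continuous_on A f" for A
    unfolding f_def by (intro continuous_at_imp_continuous_on ballI isCont_o2[OF isCont_minus[OF continuous_ident]])
  define Z where "Z = {0..x} \<inter> f -` {0}"
  have "closed Z"
    unfolding Z_def by (intro continuous_closed_preimage contf) auto
  moreover have "bounded Z"
    by (rule bounded_subset[of "{0..x}"]) (auto simp: Z_def)
  ultimately have "compact Z"
    by (simp add: compact_eq_bounded_closed)
  have "Z \<noteq> {}"
    using IVT2'[of f x 0 0] neg f0 x contf by (auto simp: Z_def)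
  then obtain z where z: "z \<in> Z" "\<And>w. w \<in> Z \<Longrightarrow> z \<le> w"
    using compact_attains_inf[OF \<open>compact Z\<close>] by blast
  have "z \<noteq> 0" using z(1) f0 by (auto simp: Z_def)
  then have z0: "0 < z" "f z = 0" "z \<le> x" using z(1) by (auto simp: Z_def)
  then obtain v where v: "0 < v" "v < 1" "f (z * v) \<le> 0"
    using mittag_leffler3_no_first_zero[OF \<alpha>, of "- z"] by (auto simp: f_def)
  \<comment> \<open>The value at \<open>z * v\<close> is only known to be nonpositive, so the zero
    below \<open>z\<close> comes from the intermediate value theorem on
    \<open>{0..z * v}\<close>.\<close>
  then obtain w where w: "0 \<le> w" "w \<le> z * v" "f w = 0"
    using IVT2'[of f "z * v" 0 0] z0 f0 contf by auto
  have "z * v < z" using v z0 by simp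
  with w z(2)[of w] z0 show False by (auto simp: Z_def)
qed

theorem proposition9:
  fixes \<alpha> :: real
  assumes "0 < \<alpha>" and "\<alpha> < 1"
  shows "\<forall>w>0. sigma_alpha \<alpha> w \<ge> 0"
  using assms mittag_leffler3_nonneg[OF assms] by (simp add: sigma_alpha_def)

end
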